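(* Let $D$ be a finite corpus and $\Phi$ a finite set of topics. The objective $\dot f$, defined on subsets $E$ of the set of topic-document links $\Phi\times D$ as in the context, is a monotone submodular set function: $\dot f(E)\le\dot f(E')$ whenever $E\subseteq E'$, and for all sets of links $A$ and all $E\subseteq E'$, $$\dot f(E\cup A)-\dot f(E)\ \ge\ \dot f(E'\cup A)-\dot f(E').$$
   Context: A corpus $D$ is a finite set of documents; each document $d=[w_{d,1},\dots,w_{d,|d|}]$ is a finite list of words from a finite vocabulary $V$. A topic $\tau\in\Phi$ is a probability distribution $\phi_\tau$ on $V$; $\phi_\tau[v]$ is the probability of word $v$ (with $\log 0=-\infty$). A link $[\tau\Rightarrow d]$ is a pair in $\Phi\times D$; for a set $E$ of links, $E_d$ denotes the set of topics linked to $d$ in $E$. The log MAP objective is $$f(E)=\sum_{d\in D}\sum_{i=1}^{|d|}\max_{\tau\in E_d}\log\phi_\tau[w_{d,i}].$$ Since $f$ is undefined when some document has no link, each document is additionally linked to an improper placeholder topic $p$ that assigns a fixed infinitesimal weight $\varepsilon>0$ to every word; with $P=\{[p\Rightarrow d]:d\in D\}$ one sets $\dot f(E)=f(E\cup P)-f(P)$, i.e. $$\dot f(E)=\sum_{d\in D}\sum_{i=1}^{|d|}\Big(\max\big\{\log\varepsilon,\max_{\tau\in E_d}\log\phi_\tau[w_{d,i}]\big\}-\log\varepsilon\Big).$$ *)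

theory Defs
  imports "HOL-Probability.Probability_Mass_Function"
begin

text \<open>The library's \<^term>\<open>ln\<close> has \<open>ln 0 = 0\<close>; here the logarithm of 0 has to be \<open>-\<infinity>\<close>.\<close>

definition elog :: "real \<Rightarrow> ereal" where
  "elog x = (if x = 0 then -\<infinity> else ereal (ln x))"

definition linked :: "('t \<times> 'd) set \<Rightarrow> 'd \<Rightarrow> 't set" where
  "linked E d = {\<tau>. (\<tau>, d) \<in> E}"

text \<open>\<open>wt \<tau> v\<close> is the weight that \<open>\<tau>\<close> assigns to the word \<open>v\<close>. Weights need not sum to 1, so that
  the improper placeholder topic is covered as well. As on paper, the value is unspecified
  (\<open>Max {}\<close>) if a nonempty document has no link.\<close>

definition log_map ::
  "'d set \<Rightarrow> ('d \<Rightarrow> 'v list) \<Rightarrow> ('t \<Rightarrow> 'v \<Rightarrow> real) \<Rightarrow> ('t \<times> 'd) set \<Rightarrow> ereal" where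
  "log_map D w wt E =
     (\<Sum>d\<in>D. \<Sum>i<length (w d). Max ((\<lambda>\<tau>. elog (wt \<tau> (w d ! i))) ` linked E d))"

text \<open>The topics are extended by the placeholder \<open>None\<close>.\<close>

definition ext_weight :: "('t \<Rightarrow> 'v pmf) \<Rightarrow> real \<Rightarrow> 't option \<Rightarrow> 'v \<Rightarrow> real" where
  "ext_weight \<phi> \<epsilon> t v = (case t of None \<Rightarrow> \<epsilon> | Some \<tau> \<Rightarrow> pmf (\<phi> \<tau>) v)"

definition embed_links :: "('t \<times> 'd) set \<Rightarrow> ('t option \<times> 'd) set" where
  "embed_links E = (\<lambda>(\<tau>, d). (Some \<tau>, d)) ` E"

definition placeholder_links :: "'d set \<Rightarrow> ('t option \<times> 'd) set" where
  "placeholder_links D = {(None, d) | d. d \<in> D}"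

definition log_map_dot ::
  "'d set \<Rightarrow> ('d \<Rightarrow> 'v list) \<Rightarrow> ('t \<Rightarrow> 'v pmf) \<Rightarrow> real \<Rightarrow> ('t \<times> 'd) set \<Rightarrow> ereal" where
  "log_map_dot D w \<phi> \<epsilon> E =
     log_map D w (ext_weight \<phi> \<epsilon>) (embed_links E \<union> placeholder_links D)
     - log_map D w (ext_weight \<phi> \<epsilon>) (placeholder_links D)"

text \<open>The explicit form of the objective, where \<open>Sup {} = -\<infinity>\<close> is the maximum over no topics.
  In particular the objective is finite, so the convention \<open>\<infinity> - \<infinity> = \<infinity>\<close> of \<^typ>\<open>ereal\<close> is
  irrelevant for its values and their differences.\<close>

lemma linked_ext:
  assumes "d \<in> D"
  shows "linked (embed_links E \<union> placeholder_links D) d = insert None (Some ` linked E d)"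
    and "linked (placeholder_links D) d = {None}"
  using assms by (force simp: linked_def embed_links_def placeholder_links_def)+

lemma Max_ext:
  assumes "finite (linked E d)" "d \<in> D"
  shows "Max ((\<lambda>\<tau>. elog (ext_weight \<phi> \<epsilon> \<tau> v)) ` linked (embed_links E \<union> placeholder_links D) d)
    = max (elog \<epsilon>) (SUP \<tau>\<in>linked E d. elog (pmf (\<phi> \<tau>) v))"
proof (cases "linked E d = {}")
  case True
  then show ?thesis using assms
    by (simp add: linked_ext ext_weight_def bot_ereal_def[symmetric])
next
  case False
  with assms show ?thesis
    by (simp add: linked_ext ext_weight_def image_image Max_Sup)
qed

lemma elog_max_finite:
  assumes "\<epsilon> > 0" "finite T"
  shows "\<bar>max (elog \<epsilon>) (SUP \<tau>\<in>T. elog (pmf (\<phi> \<tau>) v))\<bar> \<noteq> \<infinity>"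
proof -
  have "(SUP \<tau>\<in>T. elog (pmf (\<phi> \<tau>) v)) \<le> 0"
    by (rule SUP_least) (auto simp: elog_def pmf_le_1 pmf_nonneg less_le)
  moreover have "elog \<epsilon> = ereal (ln \<epsilon>)" using assms by (simp add: elog_def)
  ultimately show ?thesis by (auto simp: max_def)
qed

lemma log_map_dot_eq:
  assumes "finite D" "finite \<Phi>" "E \<subseteq> \<Phi> \<times> D" "\<epsilon> > 0"
  shows "log_map_dot D w \<phi> \<epsilon> E = (\<Sum>d\<in>D. \<Sum>i<length (w d).
    max (elog \<epsilon>) (SUP \<tau>\<in>linked E d. elog (pmf (\<phi> \<tau>) (w d ! i))) - elog \<epsilon>)"
proof -
  have fin: "finite (linked E d)" for d
    by (rule finite_subset[OF _ assms(2)]) (use assms(3) in \<open>auto simp: linked_def\<close>)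
  define g where "g d i = real_of_ereal
    (max (elog \<epsilon>) (SUP \<tau>\<in>linked E d. elog (pmf (\<phi> \<tau>) (w d ! i))))" for d i
  have g: "max (elog \<epsilon>) (SUP \<tau>\<in>linked E d. elog (pmf (\<phi> \<tau>) (w d ! i))) = ereal (g d i)" for d i
    unfolding g_def by (rule ereal_real'[OF elog_max_finite[OF assms(4) fin], symmetric])
  have e: "elog \<epsilon> = ereal (ln \<epsilon>)" using assms(4) by (simp add: elog_def)
  show ?thesis
    unfolding log_map_dot_def log_map_def
    by (simp add: Max_ext[OF fin] g cong: sum.cong)
       (simp add: linked_ext ext_weight_def e sum_subtractf)
qed

lemma log_map_dot_finite:
  assumes "finite D" "finite \<Phi>" "E \<subseteq> \<Phi> \<times> D" "\<epsilon> > 0"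
  shows "\<bar>log_map_dot D w \<phi> \<epsilon> E\<bar> \<noteq> \<infinity>"
proof -
  have fin: "finite (linked E d)" for d
    by (rule finite_subset[OF _ assms(2)]) (use assms(3) in \<open>auto simp: linked_def\<close>)
  have "\<bar>max (elog \<epsilon>) (SUP \<tau>\<in>linked E d. elog (pmf (\<phi> \<tau>) (w d ! i))) - elog \<epsilon>\<bar> \<noteq> \<infinity>" for d i
    using elog_max_finite[OF assms(4) fin[of d], of \<phi> "w d ! i"] assms(4)
    by (cases "max (elog \<epsilon>) (SUP \<tau>\<in>linked E d. elog (pmf (\<phi> \<tau>) (w d ! i)))") (auto simp: elog_def)
  then show ?thesis
    unfolding log_map_dot_eq[OF assms] by (simp add: sum_Inf del: ereal_minus_eq_minus_iff)
qed

end

theory Submission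
  imports Defs
begin

text \<open>Summand by summand the objective is a constant plus a function of the document's topic set that
  turns unions into maxima, and \<open>max a s - a\<close> is antitone in \<open>a\<close>.\<close>

text \<open>The score is taken in \<open>real\<close> so that differences obey the laws of an
  ordered group. For \<epsilon> > 0 nothing is lost: the maximum is at least
  \<open>elog \<epsilon>\<close>, and log-probabilities are at most 0, so
  \<open>real_of_ereal\<close> never meets an infinite value.\<close>

definition word_score :: "('t \<Rightarrow> 'v pmf) \<Rightarrow> real \<Rightarrow> 't set \<Rightarrow> 'v \<Rightarrow> real" where
  "word_score \<phi> \<epsilon> T v = real_of_ereal (max (elog \<epsilon>) (SUP \<tau>\<in>T. elog (pmf (\<phi> \<tau>) v)))"

lemma ereal_word_score:
  assumes "\<epsilon> > 0" "finite T"
  shows "ereal (word_score \<phi> \<epsilon> T v) = max (elog \<epsilon>) (SUP \<tau>\<in>T. elog (pmf (\<phi> \<tau>) v))"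
  unfolding word_score_def by (rule ereal_real'[OF elog_max_finite[OF assms]])

text \<open>A supremum over a union is the larger of the two suprema, and since \<open>max\<close>
  is idempotent the floor \<open>elog \<epsilon>\<close> can be repeated in both arguments.\<close>

lemma word_score_Un:
  assumes "\<epsilon> > 0" "finite S" "finite T"
  shows "word_score \<phi> \<epsilon> (S \<union> T) v = max (word_score \<phi> \<epsilon> S v) (word_score \<phi> \<epsilon> T v)"
proof -
  have "ereal (word_score \<phi> \<epsilon> (S \<union> T) v)
      = max (ereal (word_score \<phi> \<epsilon> S v)) (ereal (word_score \<phi> \<epsilon> T v))"
    using assms by (simp add: ereal_word_score SUP_union sup_max ac_simps)
  then show ?thesis by (simp flip: ereal_max)
qed

lemma word_score_mono:
  assumes "\<epsilon> > 0" "S \<subseteq> T" "finite T"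
  shows "word_score \<phi> \<epsilon> S v \<le> word_score \<phi> \<epsilon> T v"
  using word_score_Un[of \<epsilon> S T \<phi> v] assms finite_subset[OF assms(2,3)]
  by (simp add: Un_absorb1)

lemma linked_mono: "E \<subseteq> E' \<Longrightarrow> linked E d \<subseteq> linked E' d"
  by (auto simp: linked_def)

lemma linked_Un: "linked (E \<union> A) d = linked E d \<union> linked A d"
  by (auto simp: linked_def)

lemma finite_linked:
  assumes "finite \<Phi>" "E \<subseteq> \<Phi> \<times> D"
  shows "finite (linked E d)"
  by (rule finite_subset[OF _ assms(1)]) (use assms(2) in \<open>auto simp: linked_def\<close>)

text \<open>This reduces both claims about the objective to inequalities between finite real sums,
  which can be checked word by word.\<close>

lemma log_map_dot_eq_word_score:
  assumes "finite D" "finite \<Phi>" "E \<subseteq> \<Phi> \<times> D" "\<epsilon> > 0"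
  shows "log_map_dot D w \<phi> \<epsilon> E =
    ereal (\<Sum>d\<in>D. \<Sum>i<length (w d). word_score \<phi> \<epsilon> (linked E d) (w d ! i) - ln \<epsilon>)"
proof -
  have "elog \<epsilon> = ereal (ln \<epsilon>)" using assms(4) by (simp add: elog_def)
  then show ?thesis
    unfolding log_map_dot_eq[OF assms]
      ereal_word_score[OF assms(4) finite_linked[OF assms(2,3)], symmetric]
    by simp
qed

theorem mainTheorem4:
  fixes V :: "'v set" and D :: "'d set" and w :: "'d \<Rightarrow> 'v list"
    and \<Phi> :: "'t set" and \<phi> :: "'t \<Rightarrow> 'v pmf" and \<epsilon> :: real
  assumes "finite V"
    and "finite D" and "\<And>d. d \<in> D \<Longrightarrow> set (w d) \<subseteq> V"
    and "finite \<Phi>" and "\<And>\<tau>. \<tau> \<in> \<Phi> \<Longrightarrow> set_pmf (\<phi> \<tau>) \<subseteq> V"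
    and "\<epsilon> > 0"
  shows "(\<forall>E E'. E \<subseteq> E' \<and> E' \<subseteq> \<Phi> \<times> D \<longrightarrow>
            log_map_dot D w \<phi> \<epsilon> E \<le> log_map_dot D w \<phi> \<epsilon> E') \<and>
         (\<forall>A E E'. A \<subseteq> \<Phi> \<times> D \<and> E \<subseteq> E' \<and> E' \<subseteq> \<Phi> \<times> D \<longrightarrow>
            log_map_dot D w \<phi> \<epsilon> (E \<union> A) - log_map_dot D w \<phi> \<epsilon> E
            \<ge> log_map_dot D w \<phi> \<epsilon> (E' \<union> A) - log_map_dot D w \<phi> \<epsilon> E')"
proof (intro conjI allI impI)
  fix E E' assume E: "E \<subseteq> E' \<and> E' \<subseteq> \<Phi> \<times> D"
  then have sub: "E \<subseteq> \<Phi> \<times> D" "E' \<subseteq> \<Phi> \<times> D" by auto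
  have "word_score \<phi> \<epsilon> (linked E d) v \<le> word_score \<phi> \<epsilon> (linked E' d) v" for d v
    using E by (intro word_score_mono linked_mono finite_linked[OF assms(4) sub(2)] assms(6)) auto
  then show "log_map_dot D w \<phi> \<epsilon> E \<le> log_map_dot D w \<phi> \<epsilon> E'"
    by (simp add: log_map_dot_eq_word_score[OF assms(2,4) _ assms(6)] sub sum_mono)
next
  fix A E E' assume E: "A \<subseteq> \<Phi> \<times> D \<and> E \<subseteq> E' \<and> E' \<subseteq> \<Phi> \<times> D"
  then have sub: "A \<subseteq> \<Phi> \<times> D" "E \<subseteq> \<Phi> \<times> D" "E' \<subseteq> \<Phi> \<times> D"
    "E \<union> A \<subseteq> \<Phi> \<times> D" "E' \<union> A \<subseteq> \<Phi> \<times> D" by auto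
  note fin = finite_linked[OF assms(4)]
  let ?g = "\<lambda>E d i. word_score \<phi> \<epsilon> (linked E d) (w d ! i) - ln \<epsilon>"
  \<comment> \<open>The constant \<open>ln \<epsilon>\<close> cancels. If a, a' and s are the scores
    of the topics linked to d in E, E' and A, the two gains are the positive parts of s - a' and s -
    a, so a \<le> a' suffices.\<close>
  have "?g (E' \<union> A) d i - ?g E' d i \<le> ?g (E \<union> A) d i - ?g E d i" for d i
  proof -
    have "word_score \<phi> \<epsilon> (linked E d) (w d ! i) \<le> word_score \<phi> \<epsilon> (linked E' d) (w d ! i)"
      using E by (intro word_score_mono linked_mono fin[OF sub(3)] assms(6)) auto
    then show ?thesis
      by (simp add: linked_Un word_score_Un[OF assms(6)] fin[OF sub(1)] fin[OF sub(2)] fin[OF sub(3)]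
          max_def)
  qed
  then have "(\<Sum>d\<in>D. \<Sum>i<length (w d). ?g (E' \<union> A) d i - ?g E' d i)
      \<le> (\<Sum>d\<in>D. \<Sum>i<length (w d). ?g (E \<union> A) d i - ?g E d i)"
    by (intro sum_mono)
  \<comment> \<open>The sum of gains becomes the gain of the sums; this regrouping uses subtraction
    in a group and is therefore done in \<open>real\<close>, before returning to
    \<open>ereal\<close>.\<close>
  then have "(\<Sum>d\<in>D. \<Sum>i<length (w d). ?g (E' \<union> A) d i) - (\<Sum>d\<in>D. \<Sum>i<length (w d). ?g E' d i)
      \<le> (\<Sum>d\<in>D. \<Sum>i<length (w d). ?g (E \<union> A) d i) - (\<Sum>d\<in>D. \<Sum>i<length (w d). ?g E d i)"
    by (simp only: sum_subtractf)
  then show "log_map_dot D w \<phi> \<epsilon> (E \<union> A) - log_map_dot D w \<phi> \<epsilon> E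
      \<ge> log_map_dot D w \<phi> \<epsilon> (E' \<union> A) - log_map_dot D w \<phi> \<epsilon> E'"
    unfolding log_map_dot_eq_word_score[OF assms(2,4) sub(2) assms(6)]
      log_map_dot_eq_word_score[OF assms(2,4) sub(3) assms(6)]
      log_map_dot_eq_word_score[OF assms(2,4) sub(4) assms(6)]
      log_map_dot_eq_word_score[OF assms(2,4) sub(5) assms(6)]
    by (simp only: ereal_minus ereal_less_eq)
qed

end
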